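(* A formula $\varphi\in\mathcal L_\Diamond$ is satisfiable (respectively, falsifiable) over the class of dynamic posets if and only if it is satisfiable (respectively, falsifiable) over the class of dynamical systems.
   Context: Syntax: fix a countably infinite set $\mathbb P$ of propositional variables; $\mathcal L_\Diamond$ is given by $\varphi ::= \bot \mid p \mid \varphi\wedge\varphi \mid \varphi\vee\varphi \mid \varphi\to\varphi \mid \circ\varphi \mid \Diamond\varphi$ with $p\in\mathbb P$. Semantics: a dynamical system is $(X,\mathcal T,f)$ with $(X,\mathcal T)$ a topological space and $f\colon X\to X$ continuous. A valuation assigns to each formula an open set with $[\![\bot]\!]=\varnothing$, $[\![\varphi\wedge\psi]\!]=[\![\varphi]\!]\cap[\![\psi]\!]$, $[\![\varphi\vee\psi]\!]=[\![\varphi]\!]\cup[\![\psi]\!]$, $[\![\varphi\to\psi]\!]=\big((X\setminus[\![\varphi]\!])\cup[\![\psi]\!]\big)^\circ$, $[\![\circ\varphi]\!]=f^{-1}[\![\varphi]\!]$, $[\![\Diamond\varphi]\!]=\bigcup_{n<\omega}f^{-n}[\![\varphi]\!]$. A dynamic (expanding) poset is a dynamical system whose topology is the up-set topology of a partial order $\preccurlyeq$ (open sets are the upward closed sets), so that $f$ is a monotone map. $\varphi$ is satisfiable (falsifiable) over a class if there are a system in the class, a valuation on it and a point $x$ with $x\in[\![\varphi]\!]$ (respectively $x\notin[\![\varphi]\!]$). *)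

theory Defs
  imports "HOL-Analysis.Analysis"
begin

datatype fm =
    Bot
  | Var nat
  | And fm fm
  | Or fm fm
  | Imp fm fm
  | Next fm
  | Dia fm

definition dynamical_system :: "'a topology \<Rightarrow> ('a \<Rightarrow> 'a) \<Rightarrow> bool" where
  "dynamical_system T f \<longleftrightarrow> continuous_map T T f"

fun sem :: "'a topology \<Rightarrow> ('a \<Rightarrow> 'a) \<Rightarrow> (nat \<Rightarrow> 'a set) \<Rightarrow> fm \<Rightarrow> 'a set" where
  "sem T f V Bot = {}"
| "sem T f V (Var p) = V p"
| "sem T f V (And a b) = sem T f V a \<inter> sem T f V b"
| "sem T f V (Or a b) = sem T f V a \<union> sem T f V b"
| "sem T f V (Imp a b) = T interior_of ((topspace T - sem T f V a) \<union> sem T f V b)"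
| "sem T f V (Next a) = {x \<in> topspace T. f x \<in> sem T f V a}"
| "sem T f V (Dia a) = (\<Union>n. {x \<in> topspace T. (f ^^ n) x \<in> sem T f V a})"

definition valuation :: "'a topology \<Rightarrow> (nat \<Rightarrow> 'a set) \<Rightarrow> bool" where
  "valuation T V \<longleftrightarrow> (\<forall>p. openin T (V p))"

definition upset_topology :: "'a set \<Rightarrow> 'a rel \<Rightarrow> 'a topology" where
  "upset_topology X r =
     topology (\<lambda>U. U \<subseteq> X \<and> (\<forall>x\<in>U. \<forall>y. (x, y) \<in> r \<longrightarrow> y \<in> U))"

definition dynamic_poset :: "'a set \<Rightarrow> 'a rel \<Rightarrow> ('a \<Rightarrow> 'a) \<Rightarrow> bool" where
  "dynamic_poset X r f \<longleftrightarrow> partial_order_on X r \<and> dynamical_system (upset_topology X r) f"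

definition satisfiable_DS :: "'a itself \<Rightarrow> fm \<Rightarrow> bool" where
  "satisfiable_DS _ \<phi> \<longleftrightarrow> (\<exists>(T::'a topology) f V x. dynamical_system T f \<and> valuation T V \<and>
      x \<in> topspace T \<and> x \<in> sem T f V \<phi>)"

definition falsifiable_DS :: "'a itself \<Rightarrow> fm \<Rightarrow> bool" where
  "falsifiable_DS _ \<phi> \<longleftrightarrow> (\<exists>(T::'a topology) f V x. dynamical_system T f \<and> valuation T V \<and>
      x \<in> topspace T \<and> x \<notin> sem T f V \<phi>)"

definition satisfiable_DP :: "'a itself \<Rightarrow> fm \<Rightarrow> bool" where
  "satisfiable_DP _ \<phi> \<longleftrightarrow> (\<exists>(X::'a set) r f V x. dynamic_poset X r f \<and>
      valuation (upset_topology X r) V \<and> x \<in> X \<and> x \<in> sem (upset_topology X r) f V \<phi>)"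

definition falsifiable_DP :: "'a itself \<Rightarrow> fm \<Rightarrow> bool" where
  "falsifiable_DP _ \<phi> \<longleftrightarrow> (\<exists>(X::'a set) r f V x. dynamic_poset X r f \<and>
      valuation (upset_topology X r) V \<and> x \<in> X \<and> x \<notin> sem (upset_topology X r) f V \<phi>)"

end

theory Submission
  imports Defs
begin

text \<open>
  Fix a dynamical system and the finite set of subformulas of the given formula. The points of the
  poset are the finite sequences of types read off initial segments of orbits, and the map deletes
  the first entry, so that every point eventually reaches the empty sequence, which is the least
  element. Whatever holds at a segment of the orbit of a point holds at that point, for segments of
  all lengths. The converse can fail because the segment may be too short to witness the
  eventualities; its level measures up to which formula size it is long enough. Making the
  level part of the order keeps implications true, and refuting an implication only needs a
  nearby point whose orbit stays close for the length of the segment, followed for long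
  enough to raise all levels involved.
\<close>

subsection \<open>Up-set topologies\<close>

lemma openin_upset_topology:
  "openin (upset_topology X r) U \<longleftrightarrow> U \<subseteq> X \<and> (\<forall>x\<in>U. \<forall>y. (x, y) \<in> r \<longrightarrow> y \<in> U)"
proof -
  have "istopology (\<lambda>U. U \<subseteq> X \<and> (\<forall>x\<in>U. \<forall>y. (x, y) \<in> r \<longrightarrow> y \<in> U))"
    unfolding istopology_def by blast
  then show ?thesis
    unfolding upset_topology_def by (simp add: topology_inverse')
qed

lemma topspace_upset_topology:
  assumes "partial_order_on X r"
  shows "topspace (upset_topology X r) = X"
proof -
  have "r \<subseteq> X \<times> X"
    using assms by (simp add: partial_order_on_def preorder_on_def)
  then have "openin (upset_topology X r) X"
    unfolding openin_upset_topology by blast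
  then show ?thesis
    unfolding topspace_def by (auto simp: openin_upset_topology)
qed

lemma continuous_map_upset_topology:
  assumes po: "partial_order_on X r" and mono: "\<And>x y. (x, y) \<in> r \<Longrightarrow> (g x, g y) \<in> r"
  shows "continuous_map (upset_topology X r) (upset_topology X r) g"
proof -
  have r: "r \<subseteq> X \<times> X" and refl: "\<And>x. x \<in> X \<Longrightarrow> (x, x) \<in> r"
    using po by (auto simp: partial_order_on_def preorder_on_def refl_on_def)
  \<comment> \<open>Monotonicity applied to a reflexive pair keeps \<open>g x\<close> in the
    carrier.\<close>
  have "g x \<in> X" if "x \<in> X" for x
    using mono[OF refl[OF that]] r by blast
  then show ?thesis
    unfolding continuous_map_def openin_upset_topology topspace_upset_topology[OF po]
    using r mono by blast
qed

text \<open>The Kripke clause for implication. The interior is the set \<open>?U\<close> of points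
  whose successors all obey the implication: reflexivity puts \<open>?U\<close> inside the given set
  and transitivity makes it open.\<close>

lemma sem_Imp_upset_topology:
  assumes "partial_order_on X r"
  shows "x \<in> sem (upset_topology X r) g V (Imp a b) \<longleftrightarrow>
    x \<in> X \<and> (\<forall>y. (x, y) \<in> r \<longrightarrow> y \<in> sem (upset_topology X r) g V a
      \<longrightarrow> y \<in> sem (upset_topology X r) g V b)"
proof -
  let ?A = "sem (upset_topology X r) g V a" and ?B = "sem (upset_topology X r) g V b"
  let ?U = "{x \<in> X. \<forall>y. (x, y) \<in> r \<longrightarrow> y \<in> ?A \<longrightarrow> y \<in> ?B}"
  have r: "r \<subseteq> X \<times> X" and refl: "\<And>x. x \<in> X \<Longrightarrow> (x, x) \<in> r"
    and trans: "\<And>x y z. (x, y) \<in> r \<Longrightarrow> (y, z) \<in> r \<Longrightarrow> (x, z) \<in> r"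
    using assms by (auto simp: partial_order_on_def preorder_on_def refl_on_def trans_def)
  have "upset_topology X r interior_of ((X - ?A) \<union> ?B) = ?U"
  proof (rule interior_of_unique)
    show "?U \<subseteq> X - ?A \<union> ?B" using refl by blast
    show "openin (upset_topology X r) ?U"
      unfolding openin_upset_topology using r trans by blast
    show "U \<subseteq> ?U" if "U \<subseteq> X - ?A \<union> ?B" "openin (upset_topology X r) U" for U
      using that unfolding openin_upset_topology by blast
  qed
  then show ?thesis by (simp add: topspace_upset_topology[OF assms])
qed

subsection \<open>Topological semantics\<close>

lemma funpow_in_topspace:
  assumes "dynamical_system T f" "x \<in> topspace T"
  shows "(f ^^ n) x \<in> topspace T"
proof -
  have "f y \<in> topspace T" if "y \<in> topspace T" for y
    using assms(1) that unfolding dynamical_system_def continuous_map_def by blast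
  then show ?thesis using assms(2) by (induction n) simp_all
qed

lemma continuous_map_funpow:
  assumes "continuous_map T T f"
  shows "continuous_map T T (f ^^ n)"
proof (induction n)
  case (Suc n)
  show ?case unfolding funpow.simps by (rule continuous_map_compose[OF Suc assms])
qed simp

text \<open>Continuity of \<open>f\<close> and its iterates settles \<open>Next\<close> and
  \<open>Dia\<close>. Openness is what later turns agreement along an orbit segment into an open
  condition.\<close>

lemma openin_sem:
  assumes "dynamical_system T f" "valuation T V"
  shows "openin T (sem T f V \<psi>)"
proof (induction \<psi>)
  case (Dia \<psi>)
  show ?case
    using openin_continuous_map_preimage[OF continuous_map_funpow Dia] assms
    by (auto simp: dynamical_system_def intro!: openin_Union)
next
  case (Next \<psi>)
  then show ?case
    using openin_continuous_map_preimage assms by (simp add: dynamical_system_def)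
qed (use assms in \<open>auto simp: valuation_def\<close>)

fun subfms :: "fm \<Rightarrow> fm set" where
  "subfms Bot = {Bot}"
| "subfms (Var p) = {Var p}"
| "subfms (And a b) = insert (And a b) (subfms a \<union> subfms b)"
| "subfms (Or a b) = insert (Or a b) (subfms a \<union> subfms b)"
| "subfms (Imp a b) = insert (Imp a b) (subfms a \<union> subfms b)"
| "subfms (Next a) = insert (Next a) (subfms a)"
| "subfms (Dia a) = insert (Dia a) (subfms a)"

lemma finite_subfms: "finite (subfms \<phi>)"
  by (induction \<phi>) auto

lemma subfms_refl: "\<phi> \<in> subfms \<phi>"
  by (cases \<phi>) auto

lemma subfms_trans: "\<psi> \<in> subfms \<phi> \<Longrightarrow> subfms \<psi> \<subseteq> subfms \<phi>"
  by (induction \<phi>) auto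

subsection \<open>Finite sequences of types\<close>

text \<open>Each unit of level pays for one passage to the tail, as \<open>Next\<close> demands, or
  to a witness inside the sequence, as \<open>Dia\<close> demands. The conjunct
  \<open>lev k w\<close> builds in monotonicity.\<close>

fun lev :: "nat \<Rightarrow> fm set list \<Rightarrow> bool" where
  "lev 0 w = True"
| "lev (Suc k) w = (w \<noteq> [] \<and> lev k w \<and> lev k (tl w) \<and>
     (\<forall>\<psi>. Dia \<psi> \<in> hd w \<longrightarrow> (\<exists>m<length w. \<psi> \<in> w ! m \<and> lev k (drop m w))))"

lemma lev_mono: "lev k w \<Longrightarrow> j \<le> k \<Longrightarrow> lev j w"
proof (induction k)
  case (Suc k)
  then show ?case by (cases "j = Suc k") auto
qed simp

text \<open>Each level uses up one entry through \<open>tl\<close>. Hence a point above a segment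
  has only boundedly many levels to match.\<close>

lemma lev_le_length: "lev k w \<Longrightarrow> k \<le> length w"
proof (induction k arbitrary: w)
  case (Suc k)
  then have "k \<le> length (tl w)" "w \<noteq> []"
    using Suc.IH[of "tl w"] by (simp_all del: length_tl)
  then show ?case by (cases w) auto
qed simp

text \<open>Levels are compared on all suffixes, not just on the whole sequence, so that deleting
  the first entry is monotone.\<close>

definition seq_le :: "fm set list \<Rightarrow> fm set list \<Rightarrow> bool" where
  "seq_le w v \<longleftrightarrow> length w \<le> length v \<and> (\<forall>i<length w. w ! i \<subseteq> v ! i) \<and>
     (\<forall>i k. lev k (drop i w) \<longrightarrow> lev k (drop i v))"

lemma seq_le_refl: "seq_le w w"
  by (simp add: seq_le_def)

lemma seq_le_trans: "seq_le u v \<Longrightarrow> seq_le v w \<Longrightarrow> seq_le u w"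
  unfolding seq_le_def by (meson order_trans less_le_trans)

lemma seq_le_antisym: "seq_le v w \<Longrightarrow> seq_le w v \<Longrightarrow> v = w"
  unfolding seq_le_def by (metis nth_equalityI antisym)

lemma seq_le_lev: "seq_le w v \<Longrightarrow> lev k w \<Longrightarrow> lev k v"
  unfolding seq_le_def by (metis drop0)

lemma seq_le_tl:
  assumes "seq_le w v"
  shows "seq_le (tl w) (tl v)"
  unfolding seq_le_def
proof (intro conjI allI impI)
  show "length (tl w) \<le> length (tl v)"
    using assms unfolding seq_le_def by (simp add: diff_le_mono)
  then show "tl w ! i \<subseteq> tl v ! i" if "i < length (tl w)" for i
    using that assms unfolding seq_le_def by (simp add: nth_tl less_diff_conv)
  show "lev k (drop i (tl v))" if "lev k (drop i (tl w))" for i k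
    using that assms unfolding seq_le_def drop_Suc[symmetric] by blast
qed

section \<open>Segments of orbits and their levels\<close>

locale dynamical_model =
  fixes T :: "'a topology" and f :: "'a \<Rightarrow> 'a" and V :: "nat \<Rightarrow> 'a set" and \<phi> :: fm
  assumes sys: "dynamical_system T f" and val: "valuation T V"
begin

abbreviation S where "S \<equiv> sem T f V"

definition tp :: "'a \<Rightarrow> fm set" where
  "tp x = {\<psi> \<in> subfms \<phi>. x \<in> S \<psi>}"

definition seg :: "'a \<Rightarrow> nat \<Rightarrow> fm set list" where
  "seg x n = map (\<lambda>i. tp ((f ^^ i) x)) [0..<n]"

lemma length_seg [simp]: "length (seg x n) = n"
  by (simp add: seg_def)

lemma nth_seg [simp]: "i < n \<Longrightarrow> seg x n ! i = tp ((f ^^ i) x)"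
  by (simp add: seg_def)

lemma seg_eq_Nil [simp]: "seg x n = [] \<longleftrightarrow> n = 0"
  by (simp add: seg_def)

lemma hd_seg [simp]: "0 < n \<Longrightarrow> hd (seg x n) = tp x"
  by (simp add: hd_conv_nth)

text \<open>Truncated subtraction covers \<open>i > n\<close>, where both sides are empty.\<close>

lemma drop_seg [simp]: "drop i (seg x n) = seg ((f ^^ i) x) (n - i)"
proof (rule nth_equalityI)
  fix j assume "j < length (drop i (seg x n))"
  then have "i + j < n" by simp
  then show "drop i (seg x n) ! j = seg ((f ^^ i) x) (n - i) ! j"
    by (simp add: funpow_add[THEN fun_cong, unfolded comp_def] add.commute[of i j])
qed simp

lemma tl_seg [simp]: "tl (seg x n) = seg (f x) (n - 1)"
proof -
  have "tl (seg x n) = drop 1 (seg x n)" by (simp add: drop_Suc del: drop_seg)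
  then show ?thesis by simp
qed

text \<open>Only finitely many eventualities have to be witnessed at each level.\<close>

lemma eventually_lev_seg:
  assumes "x \<in> topspace T"
  shows "\<exists>N. \<forall>n\<ge>N. lev k (seg x n)"
  using assms
proof (induction k arbitrary: x)
  case (Suc k)
  have top: "(f ^^ m) x \<in> topspace T" for m
    using funpow_in_topspace[OF sys Suc.prems] .
  obtain N0 where N0: "\<And>n. n \<ge> N0 \<Longrightarrow> lev k (seg x n)"
    using Suc by blast
  obtain N1 where N1: "\<And>n. n \<ge> N1 \<Longrightarrow> lev k (seg (f x) n)"
    using Suc.IH[OF top[of 1]] by auto
  have "\<exists>m N. (f ^^ m) x \<in> S \<psi> \<and> (\<forall>n\<ge>N. lev k (seg ((f ^^ m) x) n))"
    if "Dia \<psi> \<in> tp x" for \<psi>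
    using that Suc.IH[OF top] unfolding tp_def by auto
  then obtain M L where wit: "\<And>\<psi>. Dia \<psi> \<in> tp x \<Longrightarrow> (f ^^ M \<psi>) x \<in> S \<psi>"
      "\<And>\<psi> n. Dia \<psi> \<in> tp x \<Longrightarrow> n \<ge> L \<psi> \<Longrightarrow> lev k (seg ((f ^^ M \<psi>) x) n)"
    by metis
  \<comment> \<open>A sum over the finite set of subformulas serves as a common bound; its
    \<open>1\<close> puts each witness strictly inside the segment.\<close>
  let ?K = "\<Sum>\<psi>\<in>subfms \<phi>. M \<psi> + L \<psi> + 1"
  have sub: "\<psi> \<in> subfms \<phi>" if "Dia \<psi> \<in> tp x" for \<psi>
    using that subfms_trans[of "Dia \<psi>" \<phi>] subfms_refl[of \<psi>] by (auto simp: tp_def)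
  have K: "M \<psi> + L \<psi> + 1 \<le> ?K" if "Dia \<psi> \<in> tp x" for \<psi>
    using sub[OF that] finite_subfms by (intro member_le_sum) auto
  \<comment> \<open>\<open>N1 + 1\<close> allows for the tail being one entry shorter and makes
    \<open>n\<close> positive.\<close>
  have "lev (Suc k) (seg x n)" if n: "n \<ge> N0 + (N1 + 1) + ?K" for n
  proof -
    have "\<exists>m<n. \<psi> \<in> seg x n ! m \<and> lev k (seg ((f ^^ m) x) (n - m))"
      if "Dia \<psi> \<in> tp x" for \<psi>
    proof (intro exI conjI)
      show less: "M \<psi> < n" using K[OF that] n by linarith
      show "\<psi> \<in> seg x n ! M \<psi>"
        using sub[OF that] wit(1)[OF that] less by (simp add: tp_def)
      show "lev k (seg ((f ^^ M \<psi>) x) (n - M \<psi>))"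
        using K[OF that] n by (intro wit(2)[OF that]) linarith
    qed
    moreover have "lev k (seg x n)" "lev k (seg (f x) (n - 1))"
      using n by (auto intro!: N0 N1)
    ultimately show ?thesis using n by auto
  qed
  then show ?case by blast
qed simp

text \<open>Suffixes of \<open>seg x n\<close> have level at most \<open>n\<close>, so it suffices
  that the suffixes of the new segment at positions up to \<open>n\<close> reach level
  \<open>k + n\<close>; long initial segments of the orbit of \<open>y\<close> do.\<close>

lemma seg_long_above:
  assumes y: "y \<in> topspace T" and sub: "\<And>i. i < n \<Longrightarrow> tp ((f ^^ i) x) \<subseteq> tp ((f ^^ i) y)"
  shows "\<exists>N. seq_le (seg x n) (seg y N) \<and> lev k (seg y N)"
proof -
  have "\<forall>i. \<exists>N. \<forall>m\<ge>N. lev (k + n) (seg ((f ^^ i) y) m)"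
    using eventually_lev_seg funpow_in_topspace[OF sys y] by blast
  then obtain L where L: "\<And>i m. m \<ge> L i \<Longrightarrow> lev (k + n) (seg ((f ^^ i) y) m)"
    by metis
  \<comment> \<open>The summand \<open>n\<close> makes up for the \<open>i\<close> dropped
    entries.\<close>
  define N where "N = (\<Sum>i\<le>n. L i + n)"
  have N: "L i + n \<le> N" if "i \<le> n" for i
    unfolding N_def using that by (intro member_le_sum) auto
  have lev: "lev (k + n) (seg ((f ^^ i) y) (N - i))" if "i \<le> n" for i
    using N[OF that] that by (intro L) linarith
  have "lev j (drop i (seg y N))" if "lev j (drop i (seg x n))" for i j
  proof (cases "i \<le> n")
    case True
    have "j \<le> n" using lev_le_length[OF that] by simp
    then show ?thesis using lev_mono[OF lev[OF True], of j] by simp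
  next
    case False
    then have "j = 0" using lev_le_length[OF that] by simp
    then show ?thesis by simp
  qed
  moreover have "n \<le> N" using N[of 0] by simp
  moreover have "lev k (seg y N)" using lev_mono[OF lev[of 0], of k] by simp
  ultimately show ?thesis unfolding seq_le_def using sub by (intro exI[of _ N]) auto
qed

text \<open>Types are finite and only \<open>n\<close> iterates matter, so finitely many open
  conditions are imposed.\<close>

lemma open_orbit_nbhd:
  assumes x: "x \<in> topspace T"
  shows "\<exists>U. openin T U \<and> x \<in> U \<and> (\<forall>y\<in>U. \<forall>i<n. tp ((f ^^ i) x) \<subseteq> tp ((f ^^ i) y))"
proof -
  have op: "openin T {y \<in> topspace T. (f ^^ i) y \<in> S \<psi>}" for i \<psi>
    using openin_continuous_map_preimage[OF continuous_map_funpow openin_sem[OF sys val]] sys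
    by (simp add: dynamical_system_def)
  let ?I = "Sigma {..<n} (\<lambda>i. tp ((f ^^ i) x))"
  \<comment> \<open>The intersection with \<open>topspace T\<close> takes care of an empty index
    set.\<close>
  let ?U = "(\<Inter>(i, \<psi>)\<in>?I. {y \<in> topspace T. (f ^^ i) y \<in> S \<psi>}) \<inter> topspace T"
  have "finite ?I"
    by (intro finite_SigmaI) (auto simp: tp_def finite_subfms)
  then have "openin T ?U"
    by (intro openin_INT) (auto intro: op)
  moreover have "x \<in> ?U" using x by (auto simp: tp_def)
  moreover have "tp ((f ^^ i) x) \<subseteq> tp ((f ^^ i) y)" if "y \<in> ?U" "i < n" for y i
    using that unfolding tp_def by auto
  ultimately show ?thesis by (intro exI[of _ ?U] conjI ballI allI impI)
qed

subsection \<open>The dynamic poset\<close>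

definition W :: "fm set list set" where
  "W = {seg x n |x n. x \<in> topspace T}"

text \<open>Finite sequences over finitely many types are countable, so numbering them gives a poset
  on \<open>nat\<close>.\<close>

definition enc :: "fm set list \<Rightarrow> nat" where
  "enc = to_nat_on W"

lemma inj_on_enc: "inj_on enc W"
proof -
  have "W \<subseteq> lists (Pow (subfms \<phi>))"
    by (auto simp: W_def seg_def tp_def)
  moreover have "countable (lists (Pow (subfms \<phi>)))"
    by (simp add: countable_finite finite_subfms)
  ultimately show ?thesis
    unfolding enc_def by (meson countable_subset inj_on_to_nat_on)
qed

definition R :: "nat rel" where
  "R = {(enc w, enc v) |w v. w \<in> W \<and> v \<in> W \<and> seq_le w v}"

text \<open>As \<open>tl [] = []\<close>, the empty sequence is a fixed point.\<close>

definition g :: "nat \<Rightarrow> nat" where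
  "g a = enc (tl (inv_into W enc a))"

text \<open>Since \<open>hd []\<close> is unspecified, the empty sequence is excluded
  explicitly.\<close>

definition VP :: "nat \<Rightarrow> nat set" where
  "VP p = enc ` {w \<in> W. w \<noteq> [] \<and> Var p \<in> hd w}"

abbreviation P where "P \<equiv> upset_topology (enc ` W) R"

lemma seg_in_W: "x \<in> topspace T \<Longrightarrow> seg x n \<in> W"
  by (auto simp: W_def)

lemma tl_in_W: "w \<in> W \<Longrightarrow> tl w \<in> W"
  using funpow_in_topspace[OF sys, of _ 1] unfolding W_def by fastforce

lemma enc_eq_iff: "w \<in> W \<Longrightarrow> v \<in> W \<Longrightarrow> enc w = enc v \<longleftrightarrow> w = v"
  using inj_on_enc by (meson inj_on_eq_iff)

lemma R_enc_iff: "w \<in> W \<Longrightarrow> v \<in> W \<Longrightarrow> (enc w, enc v) \<in> R \<longleftrightarrow> seq_le w v"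
  unfolding R_def using enc_eq_iff by blast

lemma g_enc: "w \<in> W \<Longrightarrow> g (enc w) = enc (tl w)"
  by (simp add: g_def inj_on_enc)

lemma funpow_g_enc:
  "x \<in> topspace T \<Longrightarrow> (g ^^ m) (enc (seg x n)) = enc (seg ((f ^^ m) x) (n - m))"
proof (induction m)
  case (Suc m)
  then show ?case
    using funpow_in_topspace[OF sys, of x m] by (simp add: g_enc seg_in_W)
qed simp

lemma partial_order_on_R: "partial_order_on (enc ` W) R"
  unfolding partial_order_on_def preorder_on_def
proof (intro conjI)
  show "R \<subseteq> enc ` W \<times> enc ` W" by (auto simp: R_def)
  show "refl_on (enc ` W) R"
    by (auto simp: refl_on_def R_enc_iff seq_le_refl)
  show "trans R"
  proof (rule transI)
    fix a b c assume "(a, b) \<in> R" "(b, c) \<in> R"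
    \<comment> \<open>The middle point is decoded twice; injectivity of \<open>enc\<close>
      identifies \<open>v\<close> and \<open>v'\<close>.\<close>
    then obtain u v v' w where "a = enc u" "b = enc v" "b = enc v'" "c = enc w"
        "{u, v, v', w} \<subseteq> W" "seq_le u v" "seq_le v' w"
      by (auto simp: R_def)
    then show "(a, c) \<in> R"
      using seq_le_trans by (auto simp: enc_eq_iff R_enc_iff)
  qed
  show "antisym R"
  proof (rule antisymI)
    fix a b assume "(a, b) \<in> R" "(b, a) \<in> R"
    then obtain u v where uv: "a = enc u" "b = enc v" "u \<in> W" "v \<in> W" "seq_le u v"
      by (auto simp: R_def)
    then have "seq_le v u" using \<open>(b, a) \<in> R\<close> by (simp add: R_enc_iff)
    then show "a = b" using uv seq_le_antisym by blast
  qed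
qed

lemma topspace_P: "topspace P = enc ` W"
  by (rule topspace_upset_topology[OF partial_order_on_R])

lemma dynamic_poset_R: "dynamic_poset (enc ` W) R g"
  unfolding dynamic_poset_def dynamical_system_def
proof (intro conjI partial_order_on_R continuous_map_upset_topology)
  fix a b assume "(a, b) \<in> R"
  then obtain w v where "a = enc w" "b = enc v" "w \<in> W" "v \<in> W" "seq_le w v"
    by (auto simp: R_def)
  then show "(g a, g b) \<in> R"
    by (simp add: g_enc R_enc_iff tl_in_W seq_le_tl)
qed

lemma valuation_VP: "valuation P VP"
  unfolding valuation_def openin_upset_topology
proof (intro allI conjI ballI impI)
  fix p a b assume a: "a \<in> VP p" and ab: "(a, b) \<in> R"
  obtain w where w: "a = enc w" "w \<in> W" "w \<noteq> []" "Var p \<in> hd w"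
    using a by (auto simp: VP_def)
  obtain v where v: "b = enc v" "v \<in> W" using ab by (auto simp: R_def)
  have le: "seq_le w v" using ab w v by (simp add: R_enc_iff)
  then have "v \<noteq> []" using w(3) by (auto simp: seq_le_def)
  moreover have "w ! 0 \<subseteq> v ! 0" using le w(3) by (simp add: seq_le_def)
  ultimately have "v \<noteq> []" "hd w \<subseteq> hd v"
    using w(3) by (simp_all add: hd_conv_nth)
  then show "b \<in> VP p" using v w by (auto simp: VP_def)
qed (auto simp: VP_def)

section \<open>Truth in the poset against truth in the system\<close>

lemma sem_Imp_P:
  assumes w: "w \<in> W"
  shows "enc w \<in> sem P g VP (Imp a b) \<longleftrightarrow>
    (\<forall>v\<in>W. seq_le w v \<longrightarrow> enc v \<in> sem P g VP a \<longrightarrow> enc v \<in> sem P g VP b)"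
proof -
  have "enc w \<in> sem P g VP (Imp a b) \<longleftrightarrow>
    (\<forall>y. (enc w, y) \<in> R \<longrightarrow> y \<in> sem P g VP a \<longrightarrow> y \<in> sem P g VP b)"
    using sem_Imp_upset_topology[OF partial_order_on_R] w by blast
  also have "\<dots> \<longleftrightarrow> (\<forall>v\<in>W. (enc w, enc v) \<in> R \<longrightarrow> enc v \<in> sem P g VP a \<longrightarrow> enc v \<in> sem P g VP b)"
    unfolding R_def by blast
  finally show ?thesis using w by (simp add: R_enc_iff)
qed

text \<open>Both directions need one induction, because each direction for an implication uses the
  other one for its antecedent. The \<open>+ 1\<close> keeps the required level positive, so that
  the segment is nonempty.\<close>

lemma sem_sound_complete:
  assumes "\<psi> \<in> subfms \<phi>" "x \<in> topspace T"
  shows "(enc (seg x n) \<in> sem P g VP \<psi> \<longrightarrow> x \<in> S \<psi>) \<and>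
    (x \<in> S \<psi> \<longrightarrow> lev (size \<psi> + 1) (seg x n) \<longrightarrow> enc (seg x n) \<in> sem P g VP \<psi>)"
  using assms
proof (induction \<psi> arbitrary: x n)
  case Bot
  then show ?case by simp
next
  case (Var p)
  have "enc (seg x n) \<in> sem P g VP (Var p) \<longleftrightarrow> n \<noteq> 0 \<and> x \<in> S (Var p)"
    using Var by (auto simp: VP_def enc_eq_iff seg_in_W tp_def)
  then show ?case by auto
next
  case (And a b)
  have sub: "a \<in> subfms \<phi>" "b \<in> subfms \<phi>"
    using subfms_trans[OF And.prems(1)] subfms_refl by auto
  have "lev (size a + 1) (seg x n) \<and> lev (size b + 1) (seg x n)"
    if "lev (size (And a b) + 1) (seg x n)"
    using that by (auto intro: lev_mono simp del: lev.simps)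
  then show ?case
    using And.IH(1)[OF sub(1) And.prems(2)] And.IH(2)[OF sub(2) And.prems(2)] by auto
next
  case (Or a b)
  have sub: "a \<in> subfms \<phi>" "b \<in> subfms \<phi>"
    using subfms_trans[OF Or.prems(1)] subfms_refl by auto
  have "lev (size a + 1) (seg x n) \<and> lev (size b + 1) (seg x n)"
    if "lev (size (Or a b) + 1) (seg x n)"
    using that by (auto intro: lev_mono simp del: lev.simps)
  then show ?case
    using Or.IH(1)[OF sub(1) Or.prems(2)] Or.IH(2)[OF sub(2) Or.prems(2)] by auto
next
  case (Imp a b)
  have sub: "a \<in> subfms \<phi>" "b \<in> subfms \<phi>"
    using subfms_trans[OF Imp.prems(1)] subfms_refl by auto
  note IHa = Imp.IH(1)[OF sub(1)] and IHb = Imp.IH(2)[OF sub(2)]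
  note W = seg_in_W[OF Imp.prems(2), of n]
  show ?case
  proof (intro conjI impI)
    assume forces: "enc (seg x n) \<in> sem P g VP (Imp a b)"
    obtain U where U: "openin T U" "x \<in> U"
        "\<And>y i. y \<in> U \<Longrightarrow> i < n \<Longrightarrow> tp ((f ^^ i) x) \<subseteq> tp ((f ^^ i) y)"
      using open_orbit_nbhd[OF Imp.prems(2), of n] by auto
    have "y \<in> S b" if y: "y \<in> U" "y \<in> S a" for y
    proof -
      have top: "y \<in> topspace T" using y U(1) openin_subset by blast
      \<comment> \<open>One segment of the orbit of \<open>y\<close> is both above
        \<open>seg x n\<close> and of a level at which the antecedent is forced.\<close>
      obtain N where N: "seq_le (seg x n) (seg y N)" "lev (size a + 1) (seg y N)"
        using seg_long_above[OF top U(3)[OF y(1)]] by blast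
      have "enc (seg y N) \<in> sem P g VP a" using IHa[OF top] y(2) N(2) by blast
      then have "enc (seg y N) \<in> sem P g VP b"
        using forces N(1) seg_in_W[OF top] unfolding sem_Imp_P[OF W] by blast
      then show ?thesis using IHb[OF top] by blast
    qed
    then have "U \<subseteq> (topspace T - S a) \<union> S b" using openin_subset[OF U(1)] by blast
    then show "x \<in> S (Imp a b)" using U by (auto simp: interior_of_def)
  next
    assume x: "x \<in> S (Imp a b)" and lev: "lev (size (Imp a b) + 1) (seg x n)"
    show "enc (seg x n) \<in> sem P g VP (Imp a b)"
      unfolding sem_Imp_P[OF W]
    proof (intro ballI impI)
      fix v assume v: "v \<in> W" "seq_le (seg x n) v" "enc v \<in> sem P g VP a"
      then obtain y m where y: "v = seg y m" "y \<in> topspace T" by (auto simp: W_def)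
      have "n \<noteq> 0" using lev by auto
      \<comment> \<open>Here \<open>y\<close> need not be near \<open>x\<close>: the implication
        reaches \<open>y\<close> as a member of the first entry.\<close>
      then have "tp x \<subseteq> tp y"
        using v(2) unfolding y(1) seq_le_def by (auto dest!: spec[of _ 0] simp: subset_iff)
      then have "y \<in> S (Imp a b)" using x Imp.prems(1) by (auto simp: tp_def)
      then have "y \<in> S a \<longrightarrow> y \<in> S b"
        using interior_of_subset by fastforce
      then have "y \<in> S b" using IHa[OF y(2), of m] v(3) y(1) by blast
      \<comment> \<open>The order preserves levels, so \<open>v\<close> is long enough for the
        consequent.\<close>
      moreover have "lev (size b + 1) (seg y m)"
        using seq_le_lev[OF v(2) lev_mono[OF lev, of "size b + 1"]] y(1) by simp
      ultimately show "enc v \<in> sem P g VP b" using IHb[OF y(2), of m] y(1) by blast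
    qed
  qed
next
  case (Next a)
  have sub: "a \<in> subfms \<phi>"
    using subfms_trans[OF Next.prems(1)] subfms_refl by auto
  have fx: "f x \<in> topspace T" using funpow_in_topspace[OF sys Next.prems(2), of 1] by simp
  have "lev (size a + 1) (seg (f x) (n - 1))" if "lev (size (Next a) + 1) (seg x n)"
    using that by simp
  then show ?case
    using Next.IH[OF sub fx, of "n - 1"] seg_in_W[OF Next.prems(2), of n] Next.prems(2)
    by (auto simp: g_enc topspace_P)
next
  case (Dia a)
  have sub: "a \<in> subfms \<phi>"
    using subfms_trans[OF Dia.prems(1)] subfms_refl by auto
  note top = funpow_in_topspace[OF sys Dia.prems(2)]
  note IH = Dia.IH[OF sub top]
  \<comment> \<open>For \<open>m \<ge> n\<close> the sequence reached is empty; this is harmless, as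
    soundness holds at every length.\<close>
  have eq: "enc (seg x n) \<in> sem P g VP (Dia a) \<longleftrightarrow>
      (\<exists>m. enc (seg ((f ^^ m) x) (n - m)) \<in> sem P g VP a)"
    using seg_in_W[OF Dia.prems(2), of n] funpow_g_enc[OF Dia.prems(2)] by (simp add: topspace_P)
  show ?case
  proof (intro conjI impI)
    assume "enc (seg x n) \<in> sem P g VP (Dia a)"
    then obtain m where "(f ^^ m) x \<in> S a" using IH unfolding eq by blast
    then show "x \<in> S (Dia a)" using Dia.prems(2) by auto
  next
    assume "x \<in> S (Dia a)" and lev: "lev (size (Dia a) + 1) (seg x n)"
    then have "Dia a \<in> tp x" using Dia.prems(1) by (simp add: tp_def)
    moreover have "n \<noteq> 0" using lev by auto
    moreover have "size (Dia a) + 1 = Suc (size a + 1)" by simp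
    \<comment> \<open>Unfolding one level gives a witness inside the segment whose remaining suffix
      has the level required for \<open>a\<close>.\<close>
    ultimately obtain m where m: "m < n" "a \<in> seg x n ! m" "lev (size a + 1) (drop m (seg x n))"
      using lev by (metis hd_seg length_seg lev.simps(2) neq0_conv)
    then have "(f ^^ m) x \<in> S a" by (simp add: tp_def)
    then have "enc (seg ((f ^^ m) x) (n - m)) \<in> sem P g VP a"
      using IH[of m "n - m"] m by (simp del: lev.simps)
    then show "enc (seg x n) \<in> sem P g VP (Dia a)" unfolding eq by blast
  qed
qed

lemma satisfiable_DP:
  assumes "x \<in> topspace T" "x \<in> S \<phi>"
  shows "satisfiable_DP TYPE(nat) \<phi>"
proof -
  obtain n where "lev (size \<phi> + 1) (seg x n)"
    using eventually_lev_seg[OF assms(1)] by blast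
  then have "enc (seg x n) \<in> sem P g VP \<phi>"
    using sem_sound_complete[OF subfms_refl assms(1)] assms(2) by blast
  then show ?thesis
    unfolding satisfiable_DP_def
    using dynamic_poset_R valuation_VP seg_in_W[OF assms(1)] by blast
qed

text \<open>Soundness carries no level condition, so the empty sequence, the least point, already
  refutes the formula.\<close>

lemma falsifiable_DP:
  assumes "x \<in> topspace T" "x \<notin> S \<phi>"
  shows "falsifiable_DP TYPE(nat) \<phi>"
proof -
  have "enc (seg x 0) \<notin> sem P g VP \<phi>"
    using sem_sound_complete[OF subfms_refl assms(1)] assms(2) by blast
  then show ?thesis
    unfolding falsifiable_DP_def
    using dynamic_poset_R valuation_VP seg_in_W[OF assms(1)] by blast
qed

end

text \<open>Dynamic posets are dynamical systems on the same carrier. Conversely the posets built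
  are countable whatever the type \<open>'a\<close>, so \<open>nat\<close> suffices as their carrier
  type.\<close>

theorem theorem10p10:
  fixes \<phi> :: fm
  shows "(satisfiable_DP TYPE('b) \<phi> \<longrightarrow> satisfiable_DS TYPE('b) \<phi>)
       \<and> (satisfiable_DS TYPE('a) \<phi> \<longrightarrow> satisfiable_DP TYPE(nat) \<phi>)
       \<and> (falsifiable_DP TYPE('b) \<phi> \<longrightarrow> falsifiable_DS TYPE('b) \<phi>)
       \<and> (falsifiable_DS TYPE('a) \<phi> \<longrightarrow> falsifiable_DP TYPE(nat) \<phi>)"
proof (intro conjI impI)
  assume "satisfiable_DP TYPE('b) \<phi>"
  then show "satisfiable_DS TYPE('b) \<phi>"
    unfolding satisfiable_DP_def satisfiable_DS_def dynamic_poset_def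
    by (metis topspace_upset_topology)
next
  assume "falsifiable_DP TYPE('b) \<phi>"
  then show "falsifiable_DS TYPE('b) \<phi>"
    unfolding falsifiable_DP_def falsifiable_DS_def dynamic_poset_def
    by (metis topspace_upset_topology)
next
  assume "satisfiable_DS TYPE('a) \<phi>"
  then show "satisfiable_DP TYPE(nat) \<phi>"
    unfolding satisfiable_DS_def
    by (auto simp: dynamical_model_def intro: dynamical_model.satisfiable_DP)
next
  assume "falsifiable_DS TYPE('a) \<phi>"
  then show "falsifiable_DP TYPE(nat) \<phi>"
    unfolding falsifiable_DS_def
    by (auto simp: dynamical_model_def intro: dynamical_model.falsifiable_DP)
qed

end
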